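(* Let $1\le p\le 2$ and $\frac1p+\frac1{p_1}=1$ (with $p_1=\infty$ if $p=1$). For every $f\in L_p(\mathbb{R})$ one has $\mathbb{F}_2f\in L_{p_1}(\mathbb{R})$, and furthermore $$\|\mathbb{F}_2f\|_{L_{p_1}(\mathbb{R})}\le \mathcal{C}_2\,\|f\|_{L_p(\mathbb{R})},\qquad \mathcal{C}_2=C_1R^{2\left(1-\frac1p\right)},$$ where $R$ is the diameter of the compact support $M$ of the function $\psi$ and $C_1$ is a constant such that $|\psi(x,y)|\le C_1$ for all $(x,y)\in M$.
   Context: Let $a,b,c\in\mathbb{R}$ and let $\psi:\mathbb{R}^2\to\mathbb{C}$ be a smooth compactly supported function with support $M\subset\mathbb{R}^2$. The operator $\mathbb{F}_2$ is defined by $$(\mathbb{F}_2f)(x)=\int_{\mathbb{R}} e^{-i(ax^2+bx+c)y}\,\psi(x,y)\,f(y)\,dy .$$ *)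

theory Defs
  imports "HOL-Analysis.Analysis" "HOL-Probability.Essential_Supremum"
begin

(* The derivatives occurring at each stage are directional derivatives in fixed but arbitrary
   directions, so on a finite-dimensional domain this is continuity of all partial derivatives
   up to order n. *)
fun n_times_cont_differentiable ::
    "nat \<Rightarrow> ('a::euclidean_space \<Rightarrow> 'b::real_normed_vector) \<Rightarrow> bool" where
  "n_times_cont_differentiable 0 f \<longleftrightarrow> continuous_on UNIV f"
| "n_times_cont_differentiable (Suc n) f \<longleftrightarrow>
     (\<forall>x. f differentiable (at x)) \<and>
     (\<forall>v. n_times_cont_differentiable n (\<lambda>x. frechet_derivative f (at x) v))"

definition smooth :: "('a::euclidean_space \<Rightarrow> 'b::real_normed_vector) \<Rightarrow> bool" where
  "smooth f \<longleftrightarrow> (\<forall>n. n_times_cont_differentiable n f)"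

definition closed_support :: "('a::topological_space \<Rightarrow> 'b::monoid_add) \<Rightarrow> 'a set" where
  "closed_support f = closure (support_on UNIV f)"

(* Elements are functions, not classes modulo a.e. equality. The exponent is meant to lie
   in [1, \<infinity>]. *)
definition Lp_space :: "ennreal \<Rightarrow> 'a measure \<Rightarrow> ('a \<Rightarrow> complex) set" where
  "Lp_space p M = {f \<in> borel_measurable M.
     if p = \<infinity> then esssup M (\<lambda>x. ennreal (norm (f x))) < \<infinity>
     else integrable M (\<lambda>x. norm (f x) powr enn2real p)}"

(* Being real-valued, this is meaningful only for f in Lp_space p M. *)
definition Lp_norm :: "ennreal \<Rightarrow> 'a measure \<Rightarrow> ('a \<Rightarrow> complex) \<Rightarrow> real" where
  "Lp_norm p M f =
     (if p = \<infinity> then enn2real (esssup M (\<lambda>x. ennreal (norm (f x))))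
      else (LINT x|M. norm (f x) powr enn2real p) powr (1 / enn2real p))"

definition F2 ::
    "real \<Rightarrow> real \<Rightarrow> real \<Rightarrow> (real \<times> real \<Rightarrow> complex) \<Rightarrow> (real \<Rightarrow> complex) \<Rightarrow> real \<Rightarrow> complex" where
  "F2 a b c \<psi> f x =
     (LINT y|lebesgue. exp (- \<i> * complex_of_real ((a * x\<^sup>2 + b * x + c) * y)) * \<psi> (x, y) * f y)"

end

theory Submission
  imports Defs
begin

text \<open>
  Since the exponential factor has modulus one and \<open>M\<close> is contained in a product \<open>I \<times> J\<close> of two
  intervals of length \<open>R\<close>, the modulus of \<open>F2 a b c \<psi> f\<close> is at most \<open>C1\<close> times the indicator of \<open>I\<close>
  times the \<open>L\<^sub>1\<close> norm of \<open>f\<close> on \<open>J\<close>. Hoelder's inequality on \<open>J\<close> and the length of \<open>I\<close> each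
  contribute a factor \<open>R powr (1 - 1 / p)\<close>.
\<close>

text \<open>In \<open>ennreal\<close> the quotient \<open>1 / 0\<close> is infinite, which excludes
  \<open>q = 0\<close>. In the reals \<open>1 / 0 = 0\<close>, and \<open>enn2real\<close> sends
  infinity to 0, so the second identity also covers the pair \<open>p = 1\<close>,
  \<open>q = \<infinity>\<close>.\<close>

lemma conjugate_exponent:
  fixes p :: real and q :: ennreal
  assumes "1 \<le> p" and "1 / ennreal p + 1 / q = 1"
  shows "q \<noteq> 0" and "1 / enn2real q = 1 - 1 / p"
proof -
  show "q \<noteq> 0"
    using assms by (auto simp: ennreal_divide_zero)
  show "1 / enn2real q = 1 - 1 / p"
  proof (cases q)
    case (real r)
    with \<open>q \<noteq> 0\<close> have "r > 0"
      by (cases "r = 0") auto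
    have "ennreal (1 / p + 1 / r) = 1"
      using assms real \<open>r > 0\<close> by (simp add: divide_ennreal ennreal_plus flip: ennreal_1)
    then have "1 / p + 1 / r = 1"
      by (simp add: ennreal_eq_1)
    then show ?thesis
      using real by simp
  next
    case top
    have "ennreal (1 / p) = 1"
      using assms top by (simp add: divide_ennreal flip: ennreal_1)
    then show ?thesis
      using top by (simp add: ennreal_eq_1)
  qed
qed

text \<open>Two points of the image are no farther apart than \<open>diameter S\<close>, so the
  interval can start at the infimum of the image. Applied to \<open>fst\<close> and
  \<open>snd\<close>, this encloses the support in a square.\<close>

lemma Lipschitz_image_subset_interval:
  fixes g :: "'a::metric_space \<Rightarrow> real"
  assumes "bounded S" and lip: "\<And>u v. dist (g u) (g v) \<le> dist u v"
  shows "\<exists>\<alpha>. g ` S \<subseteq> {\<alpha>..\<alpha> + diameter S}"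
\<comment> \<open>The left endpoint stays open until the last step. The point \<open>t\<close> shows
  that the image is nonempty, so its infimum is meaningful; for empty \<open>S\<close> the inclusion
  is vacuous.\<close>
proof (intro exI subsetI)
  fix t assume t: "t \<in> g ` S"
  have near: "\<bar>s - s'\<bar> \<le> diameter S" if "s \<in> g ` S" "s' \<in> g ` S" for s s'
  proof -
    from that obtain u v where "u \<in> S" "v \<in> S" "s = g u" "s' = g v"
      by blast
    then show ?thesis
      using order_trans[OF lip[of u v] diameter_bounded_bound[OF \<open>bounded S\<close>]]
      by (simp add: dist_real_def)
  qed
  have "t - diameter S \<le> s" if "s \<in> g ` S" for s
    using near[OF t that] by linarith
  then have lower: "t - diameter S \<le> Inf (g ` S)"
    using t by (intro cInf_greatest) auto
  have "bdd_below (g ` S)"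
    using near[OF t] by (intro bdd_belowI[of _ "t - diameter S"]) (smt (verit))
  then have "Inf (g ` S) \<le> t"
    using t by (rule cInf_lower[rotated])
  with lower show "t \<in> {Inf (g ` S)..Inf (g ` S) + diameter S}"
    by simp
qed

text \<open>Young's inequality with a free parameter \<open>s > 0\<close> is integrated first, and
  \<open>s\<close> is chosen afterwards so that the bound becomes Hoelder's.\<close>

lemma Hoelder_indicator:
  fixes h :: "'a \<Rightarrow> real"
  assumes [measurable]: "h \<in> borel_measurable M" "A \<in> sets M"
    and fin: "emeasure M A < \<infinity>" and "1 \<le> p" and nonneg: "\<And>x. 0 \<le> h x"
    and int: "integrable M (\<lambda>x. h x powr p)"
  shows "integrable M (\<lambda>x. indicator A x * h x)"
    and "(LINT x|M. indicator A x * h x)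
      \<le> measure M A powr (1 - 1 / p) * (LINT x|M. h x powr p) powr (1 / p)"
proof -
  define I where "I = (LINT x|M. h x powr p)"
  have Young: "h x * s powr (1 - 1 / p) \<le> h x powr p / p + (1 - 1 / p) * s" if "s > 0" for x s
  proof (cases "h x = 0")
    case False
    then show ?thesis
      using Youngs_inequality_0[of "1 / p" "1 - 1 / p" "h x powr p" s] that nonneg[of x] \<open>1 \<le> p\<close>
      by (simp add: powr_powr)
  qed (use that \<open>1 \<le> p\<close> in auto)
  have intA: "integrable M (\<lambda>x. indicator A x :: real)"
    using fin by simp
  \<comment> \<open>Only the second summand carries the indicator. Off \<open>A\<close> the left
    side vanishes, and the first summand is kept there so that it integrates to
    \<open>I / p\<close>.\<close>
  have bound: "indicator A x * h x * s powr (1 - 1 / p)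
      \<le> h x powr p / p + (1 - 1 / p) * s * indicator A x" if "s > 0" for x s
    using Young[OF that, of x] \<open>1 \<le> p\<close> by (auto simp: indicator_def)
  have int_rhs: "integrable M (\<lambda>x. h x powr p / p + (1 - 1 / p) * s * indicator A x)" for s
    using int intA by (intro Bochner_Integration.integrable_add integrable_divide integrable_mult_right) auto
  \<comment> \<open>For \<open>s = 1\<close> the factor \<open>s powr (1 - 1 / p)\<close> is 1, and
    \<open>bound\<close> provides an integrable majorant.\<close>
  show int_h: "integrable M (\<lambda>x. indicator A x * h x)"
    by (rule Bochner_Integration.integrable_bound[OF int_rhs[of 1]])
       (use bound[of 1] nonneg in \<open>auto intro!: AE_I2 order_trans[OF _ abs_ge_self]\<close>)
  have "0 \<le> I"
    unfolding I_def by simp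
  \<comment> \<open>The quotient \<open>I / measure M A\<close> is a legitimate \<open>s\<close>
    only if both numbers are positive. Otherwise the integrand vanishes almost everywhere.\<close>
  consider "measure M A = 0" | "I = 0" | "measure M A > 0" "I > 0"
    using \<open>0 \<le> I\<close> zero_less_measure_iff by fastforce
  then have "(LINT x|M. indicator A x * h x) \<le> measure M A powr (1 - 1 / p) * I powr (1 / p)"
  proof cases
    case 1
    then have "AE x in M. x \<notin> A"
      using fin by (intro AE_not_in) (auto simp: null_sets_def emeasure_eq_ennreal_measure)
    then have "(LINT x|M. indicator A x * h x) = (LINT x|M. 0)"
      by (intro integral_cong_AE) auto
    then show ?thesis
      by simp
  next
    case 2
    then have "AE x in M. h x powr p = 0"
      using integral_nonneg_eq_0_iff_AE[OF int] unfolding I_def by simp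
    then have "(LINT x|M. indicator A x * h x) = (LINT x|M. 0)"
      by (intro integral_cong_AE) auto
    then show ?thesis
      by simp
  next
    case 3
    \<comment> \<open>This value turns the integrated bound into
      \<open>I / p + (1 - 1 / p) * I = I\<close>.\<close>
    define s where "s = I / measure M A"
    have "s > 0"
      using 3 by (simp add: s_def)
    have "(LINT x|M. indicator A x * h x) * s powr (1 - 1 / p)
        = (LINT x|M. indicator A x * h x * s powr (1 - 1 / p))"
      by simp
    also have "\<dots> \<le> (LINT x|M. h x powr p / p + (1 - 1 / p) * s * indicator A x)"
      by (intro integral_mono int_rhs integrable_mult_left int_h bound \<open>s > 0\<close>)
    also have "\<dots> = I / p + (1 - 1 / p) * s * measure M A"
      using int intA by (subst Bochner_Integration.integral_add) (auto simp: I_def)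
    also have "\<dots> = I"
      using 3 \<open>1 \<le> p\<close> by (simp add: s_def field_simps)
    finally have "(LINT x|M. indicator A x * h x) \<le> I / s powr (1 - 1 / p)"
      using \<open>s > 0\<close> by (simp add: pos_le_divide_eq)
    also have "\<dots> = measure M A powr (1 - 1 / p) * (I / I powr (1 - 1 / p))"
      using 3 by (simp add: s_def powr_divide)
    also have "I / I powr (1 - 1 / p) = I powr (1 / p)"
      using 3 by (simp add: powr_diff)
    finally show ?thesis .
  qed
  then show "(LINT x|M. indicator A x * h x)
      \<le> measure M A powr (1 - 1 / p) * (LINT x|M. h x powr p) powr (1 / p)"
    unfolding I_def .
qed

text \<open>For \<open>q = \<infinity>\<close> the exponent \<open>1 / enn2real q\<close> is \<open>0\<close>, and \<open>0 powr 0 = 0\<close> agrees with the vanishing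
  of a function supported on a null set.\<close>

lemma Lp_bound_indicator:
  fixes g :: "'a \<Rightarrow> complex"
  assumes [measurable]: "g \<in> borel_measurable M" "A \<in> sets M"
    and fin: "emeasure M A < \<infinity>" and "0 \<le> B" and "q \<noteq> 0"
    and bound: "\<And>x. norm (g x) \<le> B * indicator A x"
  shows "g \<in> Lp_space q M" and "Lp_norm q M g \<le> B * measure M A powr (1 / enn2real q)"
proof -
  have "g \<in> Lp_space q M \<and> Lp_norm q M g \<le> B * measure M A powr (1 / enn2real q)"
  proof (cases "q = \<infinity>")
    case True
    have "AE x in M. ennreal (norm (g x)) \<le> ennreal (B * measure M A powr 0)"
    proof (cases "measure M A = 0")
      case True
      then have "AE x in M. x \<notin> A"
        using fin by (intro AE_not_in) (auto simp: null_sets_def emeasure_eq_ennreal_measure)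
      then show ?thesis
      proof eventually_elim
        case (elim x)
        then have "norm (g x) = 0"
          using bound[of x] by simp
        then show ?case
          by simp
      qed
    next
      case False
      have "norm (g x) \<le> B" for x
        using bound[of x] \<open>0 \<le> B\<close> by (cases "x \<in> A") auto
      then show ?thesis
        using False by (auto intro!: AE_I2 ennreal_leI)
    qed
    then have "esssup M (\<lambda>x. ennreal (norm (g x))) \<le> ennreal (B * measure M A powr 0)"
      by (intro esssup_I) auto
    moreover from this have "esssup M (\<lambda>x. ennreal (norm (g x))) < \<infinity>"
      by (rule order_le_less_trans) (simp add: ennreal_less_top)
    moreover have "0 \<le> B * measure M A powr 0"
      using \<open>0 \<le> B\<close> by simp
    ultimately show ?thesis
      unfolding Lp_space_def Lp_norm_def using True by (simp add: enn2real_leI del: powr_zero_eq_one)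
  next
    case False
    define r where "r = enn2real q"
    have "r > 0"
      using False \<open>q \<noteq> 0\<close> by (simp add: r_def enn2real_positive_iff less_top zero_less_iff_neq_zero)
    have pw: "norm (g x) powr r \<le> B powr r * indicator A x" for x
      using bound[of x] \<open>r > 0\<close> by (cases "x \<in> A") (auto intro: powr_mono2)
    have int_rhs: "integrable M (\<lambda>x. B powr r * indicator A x)"
      using fin by simp
    have int: "integrable M (\<lambda>x. norm (g x) powr r)"
      by (rule Bochner_Integration.integrable_bound[OF int_rhs]) (use pw in auto)
    have "(LINT x|M. norm (g x) powr r) \<le> (LINT x|M. B powr r * indicator A x)"
      by (intro integral_mono int int_rhs pw)
    also have "\<dots> = B powr r * measure M A"
      by simp
    finally have "(LINT x|M. norm (g x) powr r) powr (1 / r) \<le> (B powr r * measure M A) powr (1 / r)"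
      using \<open>r > 0\<close> by (intro powr_mono2) auto
    also have "\<dots> = B * measure M A powr (1 / r)"
      using \<open>r > 0\<close> \<open>0 \<le> B\<close> by (simp add: powr_mult powr_powr)
    finally show ?thesis
      using False int by (simp add: Lp_space_def Lp_norm_def r_def)
  qed
  then show "g \<in> Lp_space q M" and "Lp_norm q M g \<le> B * measure M A powr (1 / enn2real q)"
    by auto
qed

lemma completion_ex_borel_measurable_complex:
  fixes f :: "'a \<Rightarrow> complex"
  assumes [measurable]: "f \<in> borel_measurable (completion M)"
  shows "\<exists>f'\<in>borel_measurable M. AE x in M. f x = f' x"
proof -
  have "(\<lambda>x. Re (f x)) \<in> borel_measurable (completion M)"
      "(\<lambda>x. Im (f x)) \<in> borel_measurable (completion M)"
    by measurable
  from this[THEN completion_ex_borel_measurable_real]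
  obtain u v where [measurable]: "u \<in> borel_measurable M" "v \<in> borel_measurable M"
    and u: "AE x in M. Re (f x) = u x" and v: "AE x in M. Im (f x) = v x"
    by auto
  have "(\<lambda>x. Complex (u x) (v x)) = (\<lambda>x. of_real (u x) + \<i> * of_real (v x))"
    by (simp add: complex_eq_iff fun_eq_iff)
  then have "(\<lambda>x. Complex (u x) (v x)) \<in> borel_measurable M"
    by simp
  moreover have "AE x in M. f x = Complex (u x) (v x)"
    using u v by eventually_elim (simp add: complex_eq_iff)
  ultimately show ?thesis
    by (intro bexI[of _ "\<lambda>x. Complex (u x) (v x)"])
qed

text \<open>Measurability of a parameter integral is obtained from joint Borel measurability, but
  \<open>f\<close> is only Lebesgue measurable. Replacing \<open>f\<close> by a Borel representative
  \<open>g\<close> changes no value of the integral, for any \<open>x\<close>, and the kernel is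
  Borel because \<open>\<psi>\<close> is continuous.\<close>

lemma borel_measurable_F2:
  assumes "continuous_on UNIV \<psi>" and "f \<in> borel_measurable lebesgue"
  shows "F2 a b c \<psi> f \<in> borel_measurable lebesgue"
proof -
  have [measurable]: "\<psi> \<in> borel_measurable borel"
    using assms(1) by (rule borel_measurable_continuous_onI)
  define k where "k x y = exp (- \<i> * complex_of_real ((a * x\<^sup>2 + b * x + c) * y)) * \<psi> (x, y)" for x y
  have k[measurable]: "(\<lambda>(x, y). k x y) \<in> borel_measurable (borel \<Otimes>\<^sub>M borel)"
    unfolding k_def by measurable
  obtain g where [measurable]: "g \<in> borel_measurable lborel" and g: "AE y in lborel. f y = g y"
    using completion_ex_borel_measurable_complex[OF assms(2)] by auto
  have "F2 a b c \<psi> f x = (LINT y|lborel. k x y * g y)" for x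
  proof -
    have "F2 a b c \<psi> f x = (LINT y|lebesgue. k x y * f y)"
      by (simp add: F2_def k_def)
    also have "\<dots> = (LINT y|lebesgue. k x y * g y)"
    proof (rule integral_cong_AE)
      show "AE y in lebesgue. k x y * f y = k x y * g y"
        using AE_completion[OF g] by eventually_elim simp
      have "k x \<in> borel_measurable lebesgue"
        by (rule measurable_completion) measurable
      then show "(\<lambda>y. k x y * f y) \<in> borel_measurable lebesgue"
        using assms(2) by (rule borel_measurable_times)
      show "(\<lambda>y. k x y * g y) \<in> borel_measurable lebesgue"
        by (rule measurable_completion) measurable
    qed
    also have "\<dots> = (LINT y|lborel. k x y * g y)"
      by (rule integral_completion) measurable
    finally show ?thesis .
  qed
  then have "F2 a b c \<psi> f = (\<lambda>x. LINT y|lborel. k x y * g y)"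
    by (rule ext)
  moreover have "(\<lambda>x. LINT y|lborel. k x y * g y) \<in> borel_measurable lborel"
    by (rule lborel.borel_measurable_lebesgue_integral) measurable
  ultimately show ?thesis
    by (simp add: measurable_completion)
qed

theorem theorem2p3:
  fixes a b c :: real
    and \<psi> :: "real \<times> real \<Rightarrow> complex"
    and M :: "(real \<times> real) set"
    and R C1 p :: real
    and p1 :: ennreal
    and f :: "real \<Rightarrow> complex"
  assumes "smooth \<psi>"
    and "M = closed_support \<psi>"
    and "compact M"
    and "R = diameter M"
    and "\<forall>(x, y) \<in> M. norm (\<psi> (x, y)) \<le> C1"
    and "1 \<le> p" and "p \<le> 2"
    and "1 / ennreal p + 1 / p1 = 1"
    and "f \<in> Lp_space (ennreal p) lebesgue"
  shows "F2 a b c \<psi> f \<in> Lp_space p1 lebesgue \<and>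
    Lp_norm p1 lebesgue (F2 a b c \<psi> f)
      \<le> C1 * R powr (2 * (1 - 1 / p)) * Lp_norm (ennreal p) lebesgue f"
proof -
  have cont: "continuous_on UNIV \<psi>"
    using assms(1)[unfolded smooth_def, THEN spec, of 0] by simp
  have f[measurable]: "f \<in> borel_measurable lebesgue"
    and f_int: "integrable lebesgue (\<lambda>y. norm (f y) powr p)"
    using assms(6,9) by (auto simp: Lp_space_def)
  have in_M: "(x, y) \<in> M" if "\<psi> (x, y) \<noteq> 0" for x y
    unfolding assms(2) closed_support_def
    by (rule subsetD[OF closure_subset]) (use that in \<open>simp add: in_support_on\<close>)
  have "bounded M"
    using assms(3) by (rule compact_imp_bounded)
  have "R \<ge> 0"
    using assms(4) diameter_ge_0[OF \<open>bounded M\<close>] by simp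
  obtain \<alpha> where \<alpha>: "fst ` M \<subseteq> {\<alpha>..\<alpha> + R}"
    using Lipschitz_image_subset_interval[OF \<open>bounded M\<close> dist_fst_le]
    unfolding assms(4) by blast
  obtain \<beta> where \<beta>: "snd ` M \<subseteq> {\<beta>..\<beta> + R}"
    using Lipschitz_image_subset_interval[OF \<open>bounded M\<close> dist_snd_le]
    unfolding assms(4) by blast
  define I where "I = {\<alpha>..\<alpha> + R}"
  define J where "J = {\<beta>..\<beta> + R}"
  have [measurable]: "I \<in> sets lebesgue" "J \<in> sets lebesgue"
    by (simp_all add: I_def J_def)
  have fin: "emeasure lebesgue I < \<infinity>" "emeasure lebesgue J < \<infinity>"
    and len: "measure lebesgue I = R" "measure lebesgue J = R"
    using \<open>R \<ge> 0\<close> by (simp_all add: I_def J_def)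
  \<comment> \<open>\<open>C1\<close> can be negative only if \<open>M\<close> is empty, and then \<open>R = 0\<close>.\<close>
  define D where "D = max 0 C1"
  have "M = {}" if "C1 < 0"
    using assms(5) that by (fastforce dest: order_trans[OF norm_ge_zero])
  \<comment> \<open>If \<open>C1 < 0\<close>, both sides are 0 for every \<open>e\<close>, including
    \<open>e = 0\<close> (the case \<open>p = 1\<close>), since \<open>0 powr 0 = 0\<close>.\<close>
  then have D_R: "D * R powr e = C1 * R powr e" for e
    using assms(4) by (cases "C1 < 0") (auto simp: D_def)
  have \<psi>_bound: "norm (\<psi> (x, y)) \<le> D * (indicator I x * indicator J y)" for x y
  proof (cases "\<psi> (x, y) = 0")
    case False
    then have "x \<in> I" "y \<in> J" "norm (\<psi> (x, y)) \<le> C1"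
      using in_M[OF False] \<alpha> \<beta> assms(5) by (force simp: I_def J_def)+
    then show ?thesis
      by (simp add: D_def)
  qed (simp add: D_def)
  define K where "K = (LINT y|lebesgue. indicator J y * norm (f y))"
  have K_int: "integrable lebesgue (\<lambda>y. indicator J y * norm (f y))"
    and "K \<le> measure lebesgue J powr (1 - 1 / p) * (LINT y|lebesgue. norm (f y) powr p) powr (1 / p)"
    unfolding K_def by (rule Hoelder_indicator; use fin assms(6) f_int in simp)+
  then have K_le: "K \<le> R powr (1 - 1 / p) * Lp_norm (ennreal p) lebesgue f"
    using assms(6) by (simp add: len Lp_norm_def)
  have "K \<ge> 0"
    unfolding K_def by simp
  have bound: "norm (F2 a b c \<psi> f x) \<le> D * K * indicator I x" for x
  proof -
    have "norm (F2 a b c \<psi> f x) \<le> (LINT y|lebesgue. norm (exp (- \<i> * complex_of_real ((a * x\<^sup>2 + b * x + c) * y)) * \<psi> (x, y) * f y))"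
      unfolding F2_def by (rule integral_norm_bound)
    \<comment> \<open>The integrability required by \<open>integral_mono'\<close> is that of the
      majorant, which \<open>K_int\<close> supplies.\<close>
    also have "\<dots> \<le> (LINT y|lebesgue. D * indicator I x * (indicator J y * norm (f y)))"
    proof (rule integral_mono')
      show "integrable lebesgue (\<lambda>y. D * indicator I x * (indicator J y * norm (f y)))"
        using K_int by simp
      show "0 \<le> D * indicator I x * (indicator J y * norm (f y))" for y
        by (simp add: D_def)
      show "norm (exp (- \<i> * complex_of_real ((a * x\<^sup>2 + b * x + c) * y)) * \<psi> (x, y) * f y)
          \<le> D * indicator I x * (indicator J y * norm (f y))" for y
        using mult_right_mono[OF \<psi>_bound[of x y], of "norm (f y)"]
        by (simp add: norm_mult norm_exp_eq_Re mult_ac)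
    qed
    also have "\<dots> = D * K * indicator I x"
      by (simp add: K_def)
    finally show ?thesis .
  qed
  \<comment> \<open>The bound is the constant \<open>D * K\<close> on \<open>I\<close>, so the
    target norm contributes only a power of the length of \<open>I\<close>.\<close>
  note F2_Lp = Lp_bound_indicator[OF borel_measurable_F2[OF cont f] \<open>I \<in> sets lebesgue\<close> fin(1) _
      conjugate_exponent(1)[OF assms(6,8)] bound]
  have "0 \<le> D * K"
    using \<open>K \<ge> 0\<close> by (simp add: D_def)
  have "Lp_norm p1 lebesgue (F2 a b c \<psi> f) \<le> D * K * R powr (1 - 1 / p)"
    using F2_Lp(2)[OF \<open>0 \<le> D * K\<close>] unfolding len conjugate_exponent(2)[OF assms(6,8)] .
  also have "\<dots> \<le> D * (R powr (1 - 1 / p) * Lp_norm (ennreal p) lebesgue f) * R powr (1 - 1 / p)"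
    using K_le by (intro mult_right_mono mult_left_mono) (auto simp: D_def)
  also have "\<dots> = D * R powr (2 * (1 - 1 / p)) * Lp_norm (ennreal p) lebesgue f"
    by (simp only: mult_2 powr_add mult_ac)
  finally show ?thesis
    using F2_Lp(1)[OF \<open>0 \<le> D * K\<close>] by (simp add: D_R)
qed

end
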